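(* Let $\mathcal A,\mathcal E$ be finite sets, $P_{A,E}$ a probability distribution on $\mathcal A\times\mathcal E$, $\mathsf M$ a positive integer, $R=\log\mathsf M$ and $\varepsilon>0$. Then $$\Delta_{d,\min}(\mathsf M,\varepsilon|P_{A,E})\le(2+\sqrt\varepsilon)\min_{0\le s}e^{\frac{-sH_{1+s}^\uparrow(A|E|P_{A,E})+sR}{1+2s}},$$ $$\Delta_{I,\min}(\mathsf M,\varepsilon|P_{A,E})\le\eta\Bigl(\min_{0\le s}e^{\frac{-sH_{1+s}^\downarrow(A|E|P_{A,E})+sR}{1+s}},\ \varepsilon+\log\mathsf M\Bigr),$$ where the minima over $s\in[0,\infty)$ are understood as infima.
   Context: Logarithms are natural. $\eta(x,y)=xy-x\log x$. A sub-distribution is a nonnegative function with total sum $\le1$; $P_E(e)=\sum_aP_{A,E}(a,e)$; $\|\cdot\|_1$ is the sum of absolute values. For $s>0$, $H_{1+s}^\downarrow(A|E|P_{A,E})=-\frac1s\log\sum_{a,e}P_{A,E}(a,e)^{1+s}P_E(e)^{-s}$ and $H_{1+s}^\uparrow(A|E|P_{A,E})=-\frac{1+s}{s}\log\sum_e(\sum_aP_{A,E}(a,e)^{1+s})^{\frac1{1+s}}$; for $s=0$ both are the conditional Shannon entropy $H(A|E|P_{A,E})$. $H_{\min}(A|E|P\|Q_E)=-\log\max_{(a,e):Q_E(e)>0}\frac{P(a,e)}{Q_E(e)}$, with value $-\infty$ if $P(a,e)>0=Q_E(e)$ for some $(a,e)$; so $H_{\min}(A|E|P\|Q_E)\ge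 R$ iff $P(a,e)\le e^{-R}Q_E(e)$ for all $(a,e)$. With outer minima understood as infima, $$\Delta_{d,\min}(\mathsf M,\varepsilon|P_{A,E})=\min_{Q_E}\min_{P'_{A,E}}\Bigl[2\|P_{A,E}-P'_{A,E}\|_1+\sqrt\varepsilon\,\mathsf M^{1/2}e^{-\frac12H_{\min}(A|E|P'_{A,E}\|Q_E)}\Bigr],$$ $$\Delta_{I,\min}(\mathsf M,\varepsilon|P_{A,E})=\min_{r\in\mathbb R}\Bigl[\eta\Bigl(\min_{P'_{A,E}:\,P'_E\le P_E,\ H_{\min}(A|E|P'_{A,E}\|P_E)\ge r}\|P_{A,E}-P'_{A,E}\|_1,\ \log\mathsf M\Bigr)+\varepsilon\mathsf M e^{-r}\Bigr],$$ where $Q_E$ ranges over probability distributions on $\mathcal E$ and $P'_{A,E}$ over sub-distributions on $\mathcal A\times\mathcal E$. *)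

theory Defs
  imports "HOL-Analysis.Analysis"
begin

text \<open>
  Finite sets are rendered as finite types. A (sub-)distribution is a real function on such a type,
  and a joint distribution of \<open>A\<close> and \<open>E\<close> is a function on the product type. All logarithms are
  natural; note the library conventions \<open>ln 0 = 0\<close>, \<open>x / 0 = 0\<close> and \<open>0 powr s = 0\<close>.
\<close>

definition prob_dist :: "('x::finite \<Rightarrow> real) \<Rightarrow> bool" where
  "prob_dist P \<longleftrightarrow> (\<forall>x. 0 \<le> P x) \<and> (\<Sum>x\<in>UNIV. P x) = 1"

definition sub_dist :: "('x::finite \<Rightarrow> real) \<Rightarrow> bool" where
  "sub_dist P \<longleftrightarrow> (\<forall>x. 0 \<le> P x) \<and> (\<Sum>x\<in>UNIV. P x) \<le> 1"

definition marg_E :: "('a::finite \<times> 'e::finite \<Rightarrow> real) \<Rightarrow> 'e \<Rightarrow> real" where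
  "marg_E P e = (\<Sum>a\<in>UNIV. P (a, e))"

definition l1_norm :: "('x::finite \<Rightarrow> real) \<Rightarrow> real" where
  "l1_norm f = (\<Sum>x\<in>UNIV. \<bar>f x\<bar>)"

definition eta :: "real \<Rightarrow> real \<Rightarrow> real" where
  "eta x y = x * y - x * ln x"


text \<open>
  Conditional Shannon entropy. Terms with \<open>P (a, e) = 0\<close> vanish, as usual.
\<close>

definition cond_shannon :: "('a::finite \<times> 'e::finite \<Rightarrow> real) \<Rightarrow> real" where
  "cond_shannon P = - (\<Sum>(a, e)\<in>UNIV. P (a, e) * ln (P (a, e) / marg_E P e))"

text \<open>
  \<open>H_down s P\<close> and \<open>H_up s P\<close> are the conditional Renyi entropies of order \<open>1 + s\<close>, for \<open>s \<ge> 0\<close>.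
  Points \<open>e\<close> of marginal probability zero contribute zero to both sums.
\<close>

definition H_down :: "real \<Rightarrow> ('a::finite \<times> 'e::finite \<Rightarrow> real) \<Rightarrow> real" where
  "H_down s P =
     (if s = 0 then cond_shannon P
      else - (1 / s) * ln (\<Sum>(a, e)\<in>UNIV. P (a, e) powr (1 + s) * marg_E P e powr (- s)))"

definition H_up :: "real \<Rightarrow> ('a::finite \<times> 'e::finite \<Rightarrow> real) \<Rightarrow> real" where
  "H_up s P =
     (if s = 0 then cond_shannon P
      else - ((1 + s) / s) *
             ln (\<Sum>e\<in>UNIV. (\<Sum>a\<in>UNIV. P (a, e) powr (1 + s)) powr (1 / (1 + s))))"


text \<open>
  The min-entropy takes values in the extended reals, it is \<open>\<infinity>\<close> for \<open>P = 0\<close>. So the logarithm of a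
  nonnegative real and the exponential are extended by \<open>log 0 = -\<infinity>\<close>, \<open>exp (-\<infinity>) = 0\<close>, \<open>exp \<infinity> = \<infinity>\<close>.
\<close>

definition ext_ln :: "real \<Rightarrow> ereal" where
  "ext_ln x = (if 0 < x then ereal (ln x) else - \<infinity>)"

fun ext_exp :: "ereal \<Rightarrow> ereal" where
  "ext_exp (ereal x) = ereal (exp x)"
| "ext_exp PInfty = \<infinity>"
| "ext_exp MInfty = 0"

definition H_min :: "('a::finite \<times> 'e::finite \<Rightarrow> real) \<Rightarrow> ('e \<Rightarrow> real) \<Rightarrow> ereal" where
  "H_min P Q =
     (if \<exists>a e. P (a, e) > 0 \<and> Q e = 0 then - \<infinity>
      else - ext_ln (Max {P (a, e) / Q e | a e. Q e > 0}))"

text \<open>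
  Extended-real valued, since the bracket is \<open>\<infinity>\<close> when \<open>H_min P' Q = -\<infinity>\<close>.
\<close>

definition Delta_d_min :: "nat \<Rightarrow> real \<Rightarrow> ('a::finite \<times> 'e::finite \<Rightarrow> real) \<Rightarrow> ereal" where
  "Delta_d_min M \<epsilon> P =
     (INF Q\<in>{Q :: 'e \<Rightarrow> real. prob_dist Q}.
        INF P'\<in>{P' :: 'a \<times> 'e \<Rightarrow> real. sub_dist P'}.
          ereal (2 * l1_norm (\<lambda>x. P x - P' x))
          + ereal (sqrt \<epsilon> * real M powr (1 / 2)) * ext_exp (ereal (- (1 / 2)) * H_min P' Q))"

text \<open>
  For a probability distribution \<open>P\<close>, \<open>M > 0\<close> and \<open>\<epsilon> > 0\<close> both infima are real infima of nonempty sets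
  bounded below by 0: \<open>P' = 0\<close> is always admissible, so the inner infimum lies in \<open>{0..1}\<close>, where
  \<open>eta _ (ln M)\<close> is nonnegative.
\<close>

definition Delta_I_min :: "nat \<Rightarrow> real \<Rightarrow> ('a::finite \<times> 'e::finite \<Rightarrow> real) \<Rightarrow> real" where
  "Delta_I_min M \<epsilon> P =
     (INF r\<in>(UNIV :: real set).
        eta (INF P'\<in>{P' :: 'a \<times> 'e \<Rightarrow> real. sub_dist P' \<and> (\<forall>e. marg_E P' e \<le> marg_E P e)
                        \<and> H_min P' (marg_E P) \<ge> ereal r}.
               l1_norm (\<lambda>x. P x - P' x))
            (ln (real M))
        + \<epsilon> * real M * exp (- r))"

end

theory Submission
  imports Defs
begin

text \<open>
  Replacing \<open>P\<close> by the pointwise minimum of \<open>P\<close> and \<open>t Q\<close> is optimal among all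
  \<open>P' \<le> t Q\<close>, and its distance to \<open>P\<close> is the excess of \<open>P\<close> over \<open>t Q\<close>. By Markov's
  inequality the excess is at most \<open>t powr (- s)\<close> times the sum of
  \<open>P powr (1 + s) * Q powr (- s)\<close>. For the first bound take for \<open>Q\<close> the normalisation of
  \<open>e \<mapsto> (\<Sum>a. P (a, e) powr (1 + s)) powr (1 / (1 + s))\<close>, for the second one the marginal of \<open>P\<close>,
  and balance the two terms through \<open>t\<close>.

  In the second bound, \<open>eta _ (ln M)\<close> need not be increasing up to the infimum \<open>Y\<close> over \<open>s\<close>, so an
  upper bound on the excess does not suffice. But the excess is continuous in \<open>t\<close>, it is 1
  at \<open>t = 0\<close> and at most \<open>Y\<close> at \<open>t = Y / M\<close>. Hence it equals \<open>Y\<close> at some smaller \<open>t\<close>.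
\<close>

definition excess :: "('a::finite \<times> 'e::finite \<Rightarrow> real) \<Rightarrow> ('e \<Rightarrow> real) \<Rightarrow> real \<Rightarrow> real" where
  "excess P Q t = (\<Sum>(a, e)\<in>UNIV. max 0 (P (a, e) - t * Q e))"

definition truncated :: "('a \<times> 'e \<Rightarrow> real) \<Rightarrow> ('e \<Rightarrow> real) \<Rightarrow> real \<Rightarrow> 'a \<times> 'e \<Rightarrow> real" where
  "truncated P Q t = (\<lambda>(a, e). min (P (a, e)) (t * Q e))"

section \<open>Distributions and their marginals\<close>

lemma prob_dist_nonneg: "prob_dist P \<Longrightarrow> 0 \<le> P x"
  by (simp add: prob_dist_def)

lemma prob_dist_obtain_pos:
  assumes "prob_dist P"
  obtains x where "0 < P x"
proof -
  have "\<exists>x. P x \<noteq> 0"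
  proof (rule ccontr)
    assume "\<nexists>x. P x \<noteq> 0"
    with assms show False by (simp add: prob_dist_def)
  qed
  with prob_dist_nonneg[OF assms] that show thesis
    by (metis order_le_less)
qed

lemma sum_UNIV_prod:
  "(\<Sum>(a, e)\<in>(UNIV :: ('a::finite \<times> 'e::finite) set). f a e) = (\<Sum>e\<in>UNIV. \<Sum>a\<in>UNIV. f a e)"
proof -
  have "(\<Sum>(a, e)\<in>(UNIV :: ('a \<times> 'e) set). f a e) = (\<Sum>a\<in>UNIV. \<Sum>e\<in>UNIV. f a e)"
    by (simp add: sum.cartesian_product UNIV_Times_UNIV)
  also have "\<dots> = (\<Sum>e\<in>UNIV. \<Sum>a\<in>UNIV. f a e)"
    by (rule sum.swap)
  finally show ?thesis .
qed

lemma sum_marg_E: "(\<Sum>e\<in>UNIV. marg_E P e) = (\<Sum>x\<in>UNIV. P x)"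
  using sum_UNIV_prod[of "\<lambda>a e. P (a, e)"] by (simp add: marg_E_def)

lemma prob_dist_marg_E:
  assumes "prob_dist P"
  shows "prob_dist (marg_E P)"
  using assms by (simp add: prob_dist_def sum_marg_E) (simp add: marg_E_def sum_nonneg)

lemma le_marg_E: "(\<And>x. 0 \<le> P x) \<Longrightarrow> P (a, e) \<le> marg_E P e"
  unfolding marg_E_def by (rule member_le_sum) auto

section \<open>Excess and truncation\<close>

text \<open>Where a summand is positive, \<open>P (a, e) / (t * Q e)\<close> is at least 1, so
  multiplying by its \<open>s\<close>-th power only enlarges \<open>P (a, e)\<close>. If
  \<open>Q e = 0\<close>, the term on the right is 0 because \<open>0 powr (- s) = 0\<close>; the
  third hypothesis makes the left side vanish there too.\<close>

lemma excess_le: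
  assumes "\<And>x. 0 \<le> P x" "\<And>e. 0 \<le> Q e" "\<And>a e. Q e = 0 \<Longrightarrow> P (a, e) = 0" "0 < t" "0 \<le> s"
  shows "excess P Q t \<le> t powr (- s) * (\<Sum>(a, e)\<in>UNIV. P (a, e) powr (1 + s) * Q e powr (- s))"
proof -
  have "max 0 (P (a, e) - t * Q e) \<le> t powr (- s) * (P (a, e) powr (1 + s) * Q e powr (- s))"
    for a e
  proof (cases "P (a, e) \<le> t * Q e")
    case True
    then show ?thesis by simp
  next
    case False
    have p: "0 < P (a, e)"
      using False assms(2)[of e] \<open>0 < t\<close> by (smt (verit) mult_nonneg_nonneg)
    then have q: "0 < Q e"
      using assms(2)[of e] assms(3)[of e a] by linarith
    have "1 \<le> P (a, e) / (t * Q e)"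
      using False p q \<open>0 < t\<close> by (simp add: field_simps)
    then have "1 \<le> (P (a, e) / (t * Q e)) powr s"
      using \<open>0 \<le> s\<close> by (rule ge_one_powr_ge_zero)
    then have "P (a, e) \<le> P (a, e) * (P (a, e) / (t * Q e)) powr s"
      using p by simp
    also have "\<dots> = t powr (- s) * (P (a, e) powr (1 + s) * Q e powr (- s))"
      using p q \<open>0 < t\<close> by (simp add: powr_add powr_divide powr_mult powr_minus field_simps)
    finally have "P (a, e) \<le> t powr (- s) * (P (a, e) powr (1 + s) * Q e powr (- s))" .
    moreover have "0 < t * Q e" using q \<open>0 < t\<close> by simp
    ultimately show ?thesis using p by linarith
  qed
  then show ?thesis
    unfolding excess_def sum_distrib_left by (intro sum_mono) auto
qed

lemma excess_0: "prob_dist P \<Longrightarrow> excess P Q 0 = 1"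
  by (simp add: excess_def split_beta prob_dist_def)

lemma continuous_on_excess: "continuous_on A (excess P Q)"
  unfolding excess_def[abs_def] split_beta by (intro continuous_intros)

lemma excess_nonneg: "0 \<le> excess P Q t"
  unfolding excess_def split_beta by (intro sum_nonneg) auto

lemma excess_le_1:
  assumes "prob_dist P" "\<And>e. 0 \<le> Q e" "0 \<le> t"
  shows "excess P Q t \<le> 1"
proof -
  have "excess P Q t \<le> (\<Sum>x\<in>UNIV. P x)"
    unfolding excess_def split_beta
    using assms prob_dist_nonneg[OF assms(1)] by (intro sum_mono) auto
  with assms(1) show ?thesis by (simp add: prob_dist_def)
qed

lemma l1_norm_truncated: "l1_norm (\<lambda>x. P x - truncated P Q t x) = excess P Q t"
  unfolding l1_norm_def excess_def truncated_def split_beta by (intro sum.cong) auto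

text \<open>The optimality of truncation: at each point where \<open>P\<close> exceeds
  \<open>t Q\<close>, any \<open>P'\<close> below \<open>t Q\<close> misses \<open>P\<close> by at
  least that gap. By \<open>l1_norm_truncated\<close> the bound is attained.\<close>

lemma excess_le_l1_norm:
  assumes "\<And>a e. P' (a, e) \<le> t * Q e"
  shows "excess P Q t \<le> l1_norm (\<lambda>x. P x - P' x)"
  unfolding l1_norm_def excess_def split_beta
proof (rule sum_mono)
  fix x :: "'a \<times> 'b"
  show "max 0 (P (fst x, snd x) - t * Q (snd x)) \<le> \<bar>P x - P' x\<bar>"
    using assms[of "fst x" "snd x"] by auto
qed

lemma truncated_nonneg:
  assumes "\<And>x. 0 \<le> P x" "\<And>e. 0 \<le> Q e" "0 \<le> t"
  shows "0 \<le> truncated P Q t x"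
  using assms by (simp add: truncated_def split_beta)

lemma truncated_le: "truncated P Q t x \<le> P x" "truncated P Q t (a, e) \<le> t * Q e"
  by (simp_all add: truncated_def split_beta)

lemma sub_dist_truncated:
  assumes "prob_dist P" "\<And>e. 0 \<le> Q e" "0 \<le> t"
  shows "sub_dist (truncated P Q t)"
proof -
  have "(\<Sum>x\<in>UNIV. truncated P Q t x) \<le> (\<Sum>x\<in>UNIV. P x)"
    by (intro sum_mono truncated_le)
  moreover have "0 \<le> truncated P Q t x" for x
    using assms prob_dist_nonneg[OF assms(1)] by (simp add: truncated_nonneg)
  ultimately show ?thesis
    using assms(1) by (simp add: prob_dist_def sub_dist_def)
qed

lemma marg_E_truncated_le: "marg_E (truncated P Q t) e \<le> marg_E P e"
  unfolding marg_E_def by (intro sum_mono truncated_le)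

section \<open>Min-entropy as a pointwise bound\<close>

lemma le_uminus_ext_ln: "ereal r \<le> - ext_ln x \<longleftrightarrow> x \<le> exp (- r)"
proof (cases "0 < x")
  case True
  then have "x \<le> exp (- r) \<longleftrightarrow> ln x \<le> - r"
    by (metis exp_le_cancel_iff exp_ln)
  with True show ?thesis by (auto simp: ext_ln_def)
next
  case False
  moreover have "0 < exp (- r)" by simp
  ultimately have "x \<le> exp (- r)" by linarith
  with False show ?thesis by (simp add: ext_ln_def)
qed

text \<open>This removes extended reals from constraints on the min-entropy. A probability
  distribution \<open>Q\<close> has a point of positive mass, so the set under \<open>Max\<close> is
  nonempty.\<close>

lemma le_H_min_iff:
  assumes "\<And>x. 0 \<le> P x" and Q: "prob_dist Q"
  shows "ereal r \<le> H_min P Q \<longleftrightarrow> (\<forall>a e. P (a, e) \<le> exp (- r) * Q e)"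
proof (cases "\<exists>a e. P (a, e) > 0 \<and> Q e = 0")
  case True
  then obtain a e where "P (a, e) > 0" "Q e = 0" by blast
  then have "\<not> P (a, e) \<le> exp (- r) * Q e" by simp
  moreover have "H_min P Q = - \<infinity>" using True by (simp add: H_min_def)
  ultimately show ?thesis by auto
next
  case False
  let ?S = "{P (a, e) / Q e | a e. Q e > 0}"
  have "?S = (\<lambda>(a, e). P (a, e) / Q e) ` {(a, e). Q e > 0}" by auto
  then have "finite ?S" by simp
  moreover obtain e where "Q e > 0" using prob_dist_obtain_pos[OF Q] .
  then have "?S \<noteq> {}" by blast
  ultimately have "ereal r \<le> H_min P Q \<longleftrightarrow> (\<forall>x\<in>?S. x \<le> exp (- r))"
    unfolding H_min_def if_not_P[OF False] le_uminus_ext_ln by (rule Max_le_iff)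
  also have "\<dots> \<longleftrightarrow> (\<forall>a e. Q e > 0 \<longrightarrow> P (a, e) / Q e \<le> exp (- r))"
    by blast
  also have "\<dots> \<longleftrightarrow> (\<forall>a e. Q e > 0 \<longrightarrow> P (a, e) \<le> exp (- r) * Q e)"
    by (simp add: pos_divide_le_eq)
  also have "\<dots> \<longleftrightarrow> (\<forall>a e. P (a, e) \<le> exp (- r) * Q e)"
  proof -
    \<comment> \<open>Outside the support of \<open>Q\<close> both sides are 0, since the branch
      with value \<open>- \<infinity>\<close> is excluded.\<close>
    have "P (a, e) \<le> exp (- r) * Q e" if "\<not> Q e > 0" for a e
      using that False prob_dist_nonneg[OF Q, of e] assms(1)[of "(a, e)"]
      by (metis mult_zero_right not_le_imp_less order_le_less)
    then show ?thesis by blast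
  qed
  finally show ?thesis .
qed

lemma ext_exp_half_le:
  assumes "ereal r \<le> H"
  shows "ext_exp (ereal (- (1 / 2)) * H) \<le> ereal (exp (- r / 2))"
proof (cases H)
  case PInf
  have "ext_exp (- \<infinity>) = 0"
    by (metis MInfty_eq_minfinity ext_exp.simps(3))
  with PInf show ?thesis by simp
qed (use assms in auto)

section \<open>Bounding \<open>Delta_d_min\<close> by the excess\<close>

text \<open>The candidates are \<open>Q\<close> and the truncation of \<open>P\<close> at
  \<open>t Q\<close>, whose min-entropy relative to \<open>Q\<close> is at least
  \<open>- ln t\<close>.\<close>

lemma Delta_d_min_le:
  assumes P: "prob_dist P" and Q: "prob_dist Q" and "0 < t" and "0 \<le> \<epsilon>"
  shows "Delta_d_min M \<epsilon> P \<le> ereal (2 * excess P Q t + sqrt \<epsilon> * real M powr (1 / 2) * t powr (1 / 2))"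
proof -
  let ?T = "truncated P Q t"
  have nn: "0 \<le> ?T x" for x
    using prob_dist_nonneg[OF P] prob_dist_nonneg[OF Q] \<open>0 < t\<close> by (simp add: truncated_nonneg)
  have "ereal (- ln t) \<le> H_min ?T Q"
    using \<open>0 < t\<close> by (simp add: le_H_min_iff[of ?T, OF nn Q] truncated_le)
  then have "ext_exp (ereal (- (1 / 2)) * H_min ?T Q) \<le> ereal (exp (ln t / 2))"
    using ext_exp_half_le by fastforce
  also have "exp (ln t / 2) = t powr (1 / 2)"
    using \<open>0 < t\<close> by (simp add: powr_def)
  finally have H: "ext_exp (ereal (- (1 / 2)) * H_min ?T Q) \<le> ereal (t powr (1 / 2))" .
  have "Delta_d_min M \<epsilon> P \<le> ereal (2 * l1_norm (\<lambda>x. P x - ?T x))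
      + ereal (sqrt \<epsilon> * real M powr (1 / 2)) * ext_exp (ereal (- (1 / 2)) * H_min ?T Q)"
    unfolding Delta_d_min_def
    using Q sub_dist_truncated[OF P prob_dist_nonneg[OF Q], of t] \<open>0 < t\<close>
    by (intro INF_lower2[of Q] INF_lower2[of ?T]) auto
  also have "\<dots> \<le> ereal (2 * excess P Q t)
      + ereal (sqrt \<epsilon> * real M powr (1 / 2)) * ereal (t powr (1 / 2))"
    using H \<open>0 \<le> \<epsilon>\<close> by (intro add_mono ereal_mult_left_mono) (auto simp: l1_norm_truncated)
  finally show ?thesis by simp
qed

section \<open>Exponentials of the Renyi entropies\<close>

text \<open>Multiplying by \<open>s\<close> clears the denominator of the entropy, so the Shannon
  case \<open>s = 0\<close> fits the same formula: there both sides are 1.\<close>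

lemma exp_H_up:
  assumes P: "prob_dist P" and "0 \<le> s"
  defines "S \<equiv> (\<Sum>e\<in>UNIV. (\<Sum>a\<in>UNIV. P (a, e) powr (1 + s)) powr (1 / (1 + s)))"
  shows "0 < S" and "exp (- s * H_up s P) = S powr (1 + s)"
proof -
  obtain a e where "0 < P (a, e)" using prob_dist_obtain_pos[OF P] by (metis surj_pair)
  then have "0 < (\<Sum>a\<in>UNIV. P (a, e) powr (1 + s))"
    by (intro sum_pos2[of _ a]) auto
  then show S: "0 < S"
    unfolding S_def by (intro sum_pos2[of _ e]) auto
  show "exp (- s * H_up s P) = S powr (1 + s)"
  proof (cases "s = 0")
    case True
    have "S = (\<Sum>e\<in>UNIV. marg_E P e)"
      using True prob_dist_nonneg[OF P] by (simp add: S_def marg_E_def sum_nonneg)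
    with P True show ?thesis by (simp add: sum_marg_E prob_dist_def)
  next
    case False
    then have "H_up s P = - ((1 + s) / s) * ln S"
      by (simp add: H_up_def S_def)
    then have "- s * H_up s P = (1 + s) * ln S"
      using False by simp
    with S show ?thesis by (simp add: powr_def)
  qed
qed

lemma exp_H_down:
  assumes P: "prob_dist P" and "0 \<le> s"
  defines "T \<equiv> (\<Sum>(a, e)\<in>UNIV. P (a, e) powr (1 + s) * marg_E P e powr (- s))"
  shows "0 < T" and "exp (- s * H_down s P) = T"
proof -
  obtain a e where "0 < P (a, e)" using prob_dist_obtain_pos[OF P] by (metis surj_pair)
  moreover from this have "0 < marg_E P e"
    using le_marg_E[of P a e, OF prob_dist_nonneg[OF P]] by linarith
  ultimately show T: "0 < T"
    unfolding T_def by (intro sum_pos2[of _ "(a, e)"]) auto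
  show "exp (- s * H_down s P) = T"
  proof (cases "s = 0")
    case True
    have "T = (\<Sum>x\<in>UNIV. P x)"
      unfolding T_def
    proof (rule sum.cong[OF refl], clarify)
      fix a e
      show "P (a, e) powr (1 + s) * marg_E P e powr (- s) = P (a, e)"
        using True le_marg_E[of P a e, OF prob_dist_nonneg[OF P]] prob_dist_nonneg[OF P, of "(a, e)"]
        \<comment> \<open>For a vanishing marginal, \<open>0 powr 0 = 0\<close> agrees with
          \<open>P (a, e) = 0\<close>.\<close>
        by (cases "marg_E P e = 0") auto
    qed
    with P True show ?thesis by (simp add: prob_dist_def)
  next
    case False
    with T show ?thesis by (simp add: H_down_def flip: T_def)
  qed
qed

section \<open>The first bound\<close>

lemma Delta_d_min_le_H_up:
  fixes P :: "'a::finite \<times> 'e::finite \<Rightarrow> real"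
  assumes P: "prob_dist P" and "M > 0" "\<epsilon> > 0" "0 \<le> s"
  shows "Delta_d_min M \<epsilon> P \<le>
    ereal ((2 + sqrt \<epsilon>) * exp ((- s * H_up s P + s * ln (real M)) / (1 + 2 * s)))"
proof -
  define q where "q = (\<lambda>e. (\<Sum>a\<in>UNIV. P (a, e) powr (1 + s)) powr (1 / (1 + s)))"
  define S where "S = (\<Sum>e\<in>UNIV. q e)"
  define Q where "Q = (\<lambda>e. q e / S)"
  define X where "X = exp ((- s * H_up s P + s * ln (real M)) / (1 + 2 * s))"
  \<comment> \<open>This \<open>t\<close> balances the two terms: \<open>sqrt (M * t) = X\<close>,
    and \<open>t powr (- s) * S powr (1 + s) = X\<close> amounts to
    \<open>X powr (1 + 2 * s) = M powr s * exp (- s * H_up s P)\<close>, which is how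
    \<open>X\<close> is defined.\<close>
  define t where "t = X\<^sup>2 / real M"
  have S: "0 < S" and HS: "exp (- s * H_up s P) = S powr (1 + s)"
    using exp_H_up[OF P \<open>0 \<le> s\<close>] by (simp_all add: S_def q_def)
  have q0: "0 \<le> q e" for e by (simp add: q_def)
  have Q: "prob_dist Q"
    using S q0 by (simp add: prob_dist_def Q_def flip: sum_divide_distrib) (simp add: S_def)
  have X: "0 < X" by (simp add: X_def)
  have t: "0 < t" using X \<open>M > 0\<close> by (simp add: t_def)
  have q_sum: "(\<Sum>a\<in>UNIV. P (a, e) powr (1 + s)) = q e powr (1 + s)" for e
    using \<open>0 \<le> s\<close> by (simp add: q_def powr_powr sum_nonneg)
  have PQ: "P (a, e) = 0" if "Q e = 0" for a e
  proof -
    have "(\<Sum>a\<in>UNIV. P (a, e) powr (1 + s)) = 0"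
      using that S q_sum[of e] by (simp add: Q_def)
    then show ?thesis by (simp add: sum_nonneg_eq_0_iff)
  qed
  have "(\<Sum>(a, e)\<in>UNIV. P (a, e) powr (1 + s) * Q e powr (- s))
      = (\<Sum>e\<in>UNIV. (\<Sum>a\<in>UNIV. P (a, e) powr (1 + s)) * Q e powr (- s))"
    by (simp add: sum_UNIV_prod sum_distrib_right)
  also have "\<dots> = (\<Sum>e\<in>UNIV. q e * S powr s)"
  proof (intro sum.cong refl)
    fix e
    show "(\<Sum>a\<in>UNIV. P (a, e) powr (1 + s)) * Q e powr (- s) = q e * S powr s"
      using S q0[of e] unfolding q_sum Q_def
      \<comment> \<open>For \<open>q e > 0\<close> this is
        \<open>q powr (1 + s) * (q / S) powr (- s) = q * S powr s\<close>; for
        \<open>q e = 0\<close> both sides are 0.\<close>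
      by (cases "q e = 0") (auto simp: powr_divide powr_minus powr_add field_simps)
  qed
  also have "\<dots> = S powr (1 + s)"
    using S by (simp add: S_def powr_add flip: sum_distrib_right)
  finally have sum_eq: "(\<Sum>(a, e)\<in>UNIV. P (a, e) powr (1 + s) * Q e powr (- s)) = S powr (1 + s)" .
  have "excess P Q t \<le> t powr (- s) * S powr (1 + s)"
    using excess_le[of P Q, OF prob_dist_nonneg[OF P] prob_dist_nonneg[OF Q] PQ t \<open>0 \<le> s\<close>]
    by (simp only: sum_eq)
  also have "\<dots> = X"
  proof -
    define h where "h = - s * H_up s P"
    have "ln X * (1 + 2 * s) = h + s * ln (real M)"
      using \<open>0 \<le> s\<close> by (simp add: X_def h_def)
    then have e: "- s * (2 * ln X - ln (real M)) + h = ln X"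
      by (simp add: algebra_simps)
    have "ln t = 2 * ln X - ln (real M)"
      using X \<open>M > 0\<close> by (simp add: t_def ln_div ln_realpow)
    then have "t powr (- s) = exp (- s * (2 * ln X - ln (real M)))"
      using t by (simp add: powr_def)
    moreover have "S powr (1 + s) = exp h" using HS h_def by simp
    ultimately have "t powr (- s) * S powr (1 + s) = exp (- s * (2 * ln X - ln (real M)) + h)"
      by (simp only: exp_add)
    also have "\<dots> = X" unfolding e using X by simp
    finally show ?thesis .
  qed
  finally have ex: "excess P Q t \<le> X" .
  have "real M powr (1 / 2) * t powr (1 / 2) = (real M * t) powr (1 / 2)"
    using t by (simp add: powr_mult)
  also have "\<dots> = X"
    using X \<open>M > 0\<close> by (simp add: t_def powr_half_sqrt)
  finally have "sqrt \<epsilon> * real M powr (1 / 2) * t powr (1 / 2) = sqrt \<epsilon> * X"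
    by (simp only: mult.assoc)
  then have "2 * excess P Q t + sqrt \<epsilon> * real M powr (1 / 2) * t powr (1 / 2)
      = 2 * excess P Q t + sqrt \<epsilon> * X"
    by (simp only:)
  also have "\<dots> \<le> (2 + sqrt \<epsilon>) * X"
    using ex by (simp add: algebra_simps)
  finally have "2 * excess P Q t + sqrt \<epsilon> * real M powr (1 / 2) * t powr (1 / 2) \<le> (2 + sqrt \<epsilon>) * X" .
  then show ?thesis
    using Delta_d_min_le[OF P Q t, of \<epsilon> M] \<open>\<epsilon> > 0\<close> unfolding X_def
    by (meson ereal_less_eq(3) less_imp_le order_trans)
qed

lemma Delta_d_min_le_INF:
  assumes P: "prob_dist P" and "M > 0" "\<epsilon> > 0"
  shows "Delta_d_min M \<epsilon> P \<le>
    ereal ((2 + sqrt \<epsilon>) * (INF s\<in>{0..}. exp ((- s * H_up s P + s * ln (real M)) / (1 + 2 * s))))"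
proof -
  let ?X = "\<lambda>s. exp ((- s * H_up s P + s * ln (real M)) / (1 + 2 * s))"
  have le: "Delta_d_min M \<epsilon> P \<le> ereal ((2 + sqrt \<epsilon>) * ?X s)" if "0 \<le> s" for s
    using Delta_d_min_le_H_up[OF assms that] .
  have k: "0 < 2 + sqrt \<epsilon>" using \<open>\<epsilon> > 0\<close> by (simp add: add_pos_pos)
  show ?thesis
  \<comment> \<open>The infimum over \<open>s\<close> is a real one, so it is compared with a real
    value only; \<open>\<infinity>\<close> is refuted by the bound at \<open>s = 0\<close>.\<close>
  proof (cases "Delta_d_min M \<epsilon> P")
    case (real d)
    have "d / (2 + sqrt \<epsilon>) \<le> (INF s\<in>{0..}. ?X s)"
    proof (rule cINF_greatest)
      fix s :: real assume "s \<in> {0..}"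
      then have "d \<le> (2 + sqrt \<epsilon>) * ?X s" using le[of s] unfolding real by simp
      then show "d / (2 + sqrt \<epsilon>) \<le> ?X s"
        using k by (simp add: pos_divide_le_eq mult.commute)
    qed simp
    then show ?thesis
      unfolding real using k by (simp add: pos_divide_le_eq mult.commute)
  next
    case PInf
    with le[of 0] show ?thesis by simp
  qed simp
qed

section \<open>The second bound\<close>

text \<open>The entropy constraint says that \<open>P'\<close> lies below \<open>exp (- r)\<close>
  times the marginal, so truncation attains the minimum. The exact value is what allows substitution
  into the non-monotone \<open>eta\<close>.\<close>

lemma INF_l1_norm_eq_excess:
  fixes P :: "'a::finite \<times> 'e::finite \<Rightarrow> real"
  assumes P: "prob_dist P"
  shows "(INF P'\<in>{P'. sub_dist P' \<and> (\<forall>e. marg_E P' e \<le> marg_E P e) \<and> H_min P' (marg_E P) \<ge> ereal r}.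
      l1_norm (\<lambda>x. P x - P' x)) = excess P (marg_E P) (exp (- r))"
proof (rule cInf_eq_minimum)
  let ?T = "truncated P (marg_E P) (exp (- r))"
  note Q = prob_dist_marg_E[OF P]
  have sub: "sub_dist ?T"
    using prob_dist_nonneg[OF Q] by (simp add: sub_dist_truncated[OF P])
  then have nonneg: "0 \<le> ?T x" for x unfolding sub_dist_def by blast
  have "H_min ?T (marg_E P) \<ge> ereal r"
    by (simp add: le_H_min_iff[of ?T, OF nonneg Q] truncated_le)
  then have "?T \<in> {P'. sub_dist P' \<and> (\<forall>e. marg_E P' e \<le> marg_E P e) \<and> H_min P' (marg_E P) \<ge> ereal r}"
    using sub by (simp add: marg_E_truncated_le)
  then show "excess P (marg_E P) (exp (- r)) \<in> (\<lambda>P'. l1_norm (\<lambda>x. P x - P' x)) `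
      {P'. sub_dist P' \<and> (\<forall>e. marg_E P' e \<le> marg_E P e) \<and> H_min P' (marg_E P) \<ge> ereal r}"
    by (rule rev_image_eqI) (simp add: l1_norm_truncated)
next
  fix x assume "x \<in> (\<lambda>P'. l1_norm (\<lambda>x. P x - P' x)) `
      {P'. sub_dist P' \<and> (\<forall>e. marg_E P' e \<le> marg_E P e) \<and> H_min P' (marg_E P) \<ge> ereal r}"
  then obtain P' :: "'a \<times> 'e \<Rightarrow> real" where x: "x = l1_norm (\<lambda>x. P x - P' x)"
    and "sub_dist P'" "H_min P' (marg_E P) \<ge> ereal r" by auto
  then show "excess P (marg_E P) (exp (- r)) \<le> x"
    using le_H_min_iff[of P' "marg_E P" r] prob_dist_marg_E[OF P]
    by (auto simp: sub_dist_def x intro!: excess_le_l1_norm)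
qed

text \<open>Used to bound the real infimum over \<open>r\<close> from below.\<close>

lemma eta_nonneg:
  assumes "0 \<le> x" "x \<le> 1" "0 \<le> y"
  shows "0 \<le> eta x y"
proof (cases "x = 0")
  case False
  with assms have "x * ln x \<le> 0" by (intro mult_nonneg_nonpos) auto
  moreover have "0 \<le> x * y" using assms by simp
  ultimately show ?thesis by (simp add: eta_def)
qed (simp add: eta_def)

lemma Delta_I_min_le:
  assumes P: "prob_dist P" and "M > 0" "\<epsilon> > 0" "t > 0"
  shows "Delta_I_min M \<epsilon> P \<le> eta (excess P (marg_E P) t) (ln (real M)) + \<epsilon> * real M * t"
proof -
  have "Delta_I_min M \<epsilon> P
      = (INF r. eta (excess P (marg_E P) (exp (- r))) (ln (real M)) + \<epsilon> * real M * exp (- r))"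
    unfolding Delta_I_min_def INF_l1_norm_eq_excess[OF P] ..
  \<comment> \<open>The witness is \<open>r = - ln t\<close>, left unsimplified to match the
    instance of the infimum.\<close>
  also have "\<dots> \<le> eta (excess P (marg_E P) (exp (- (- ln t)))) (ln (real M))
      + \<epsilon> * real M * exp (- (- ln t))"
  proof (rule cINF_lower)
    have "0 \<le> eta (excess P (marg_E P) (exp (- r))) (ln (real M)) + \<epsilon> * real M * exp (- r)" for r
      using prob_dist_nonneg[OF prob_dist_marg_E[OF P]] \<open>M > 0\<close> \<open>\<epsilon> > 0\<close>
      by (intro add_nonneg_nonneg eta_nonneg excess_nonneg excess_le_1[OF P]) auto
    then show "bdd_below (range (\<lambda>r. eta (excess P (marg_E P) (exp (- r))) (ln (real M))
        + \<epsilon> * real M * exp (- r)))"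
      by (intro bdd_belowI2)
  qed simp
  finally show ?thesis using \<open>t > 0\<close> by simp
qed

text \<open>\<open>Y\<close> solves \<open>t powr (- s) * exp (- s * H_down s P) = Y\<close> for
  \<open>t = Y / M\<close>, that is,
  \<open>Y powr (1 + s) = M powr s * exp (- s * H_down s P)\<close>. With this \<open>t\<close> the
  penalty \<open>\<epsilon> * M * t\<close> is \<open>\<epsilon> * Y\<close>.\<close>

lemma excess_marg_E_le_H_down:
  fixes P :: "'a::finite \<times> 'e::finite \<Rightarrow> real"
  assumes P: "prob_dist P" and "M > 0" "0 \<le> s"
  defines "Y \<equiv> exp ((- s * H_down s P + s * ln (real M)) / (1 + s))"
  shows "excess P (marg_E P) (Y / real M) \<le> Y"
proof -
  note Q = prob_dist_marg_E[OF P]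
  define t where "t = Y / real M"
  have Y: "0 < Y" by (simp add: Y_def)
  have t: "0 < t" using Y \<open>M > 0\<close> by (simp add: t_def)
  have PQ: "P (a, e) = 0" if "marg_E P e = 0" for a e
    using that le_marg_E[of P a e, OF prob_dist_nonneg[OF P]] prob_dist_nonneg[OF P, of "(a, e)"]
    by linarith
  define h where "h = - s * H_down s P"
  have "excess P (marg_E P) t \<le> t powr (- s) * exp h"
    using excess_le[of P "marg_E P", OF prob_dist_nonneg[OF P] prob_dist_nonneg[OF Q] PQ t \<open>0 \<le> s\<close>]
    by (simp only: exp_H_down(2)[OF P \<open>0 \<le> s\<close>] h_def)
  also have "\<dots> = Y"
  proof -
    have "ln Y * (1 + s) = h + s * ln (real M)"
      using \<open>0 \<le> s\<close> by (simp add: Y_def h_def)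
    then have e: "- s * (ln Y - ln (real M)) + h = ln Y"
      by (simp add: algebra_simps)
    have "ln t = ln Y - ln (real M)"
      using Y \<open>M > 0\<close> by (simp add: t_def ln_div)
    then have "t powr (- s) = exp (- s * (ln Y - ln (real M)))"
      using t by (simp add: powr_def)
    then have "t powr (- s) * exp h = exp (- s * (ln Y - ln (real M)) + h)"
      by (simp only: exp_add)
    also have "\<dots> = Y" unfolding e using Y by simp
    finally show ?thesis .
  qed
  finally show ?thesis by (simp add: t_def)
qed

lemma Delta_I_min_le_eta:
  assumes P: "prob_dist P" and "M > 0" "\<epsilon> > 0"
    and "0 \<le> Y" "Y \<le> 1" and ex: "excess P (marg_E P) (Y / real M) \<le> Y"
  shows "Delta_I_min M \<epsilon> P \<le> eta Y (\<epsilon> + ln (real M))"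
proof (cases "Y = 1")
  case True
  \<comment> \<open>For \<open>Y = 1\<close> the intermediate value theorem might only return
    \<open>t = 0\<close>, which is not of the form \<open>exp (- r)\<close>. Instead
    \<open>t\<close> tends to 0 from the right, where the excess tends to 1 and the penalty to
    0.\<close>
  let ?f = "\<lambda>t. eta (excess P (marg_E P) t) (ln (real M)) + \<epsilon> * real M * t"
  have "(excess P (marg_E P) \<longlongrightarrow> 1) (at_right 0)"
    using continuous_on_excess[of UNIV P "marg_E P"] excess_0[OF P, of "marg_E P"]
    by (metis UNIV_I continuous_on_def tendsto_within_subset subset_UNIV)
  then have "(?f \<longlongrightarrow> 1 * ln (real M) - 1 * ln 1 + \<epsilon> * real M * 0) (at_right 0)"
    unfolding eta_def by (intro tendsto_intros) auto
  then have "Delta_I_min M \<epsilon> P \<le> 1 * ln (real M) - 1 * ln 1 + \<epsilon> * real M * 0"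
  proof (rule tendsto_lowerbound)
    show "\<forall>\<^sub>F t in at_right 0. Delta_I_min M \<epsilon> P \<le> ?f t"
      using Delta_I_min_le[OF P \<open>M > 0\<close> \<open>\<epsilon> > 0\<close>]
      by (auto intro: eventually_mono[OF eventually_at_right_less])
  qed simp
  with True \<open>\<epsilon> > 0\<close> show ?thesis by (simp add: eta_def)
next
  case False
  have "\<exists>t\<ge>0. t \<le> Y / real M \<and> excess P (marg_E P) t = Y"
    using ex \<open>0 \<le> Y\<close> \<open>Y \<le> 1\<close>
    by (intro IVT2') (auto simp: excess_0[OF P] continuous_on_excess)
  then obtain t where t: "0 \<le> t" "t \<le> Y / real M" "excess P (marg_E P) t = Y" by blast
  have "t \<noteq> 0" using t(3) False excess_0[OF P] by metis
  with t(1) have "Delta_I_min M \<epsilon> P \<le> eta Y (ln (real M)) + \<epsilon> * real M * t"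
    using Delta_I_min_le[OF P \<open>M > 0\<close> \<open>\<epsilon> > 0\<close>, of t] t(3) by simp
  also have "real M * t \<le> Y" using t(2) \<open>M > 0\<close> by (simp add: field_simps)
  then have "eta Y (ln (real M)) + \<epsilon> * real M * t \<le> eta Y (ln (real M)) + \<epsilon> * Y"
    using \<open>\<epsilon> > 0\<close> by (simp add: mult.assoc)
  \<comment> \<open>\<open>eta\<close> is affine in its second argument with slope \<open>Y\<close>,
    which absorbs \<open>\<epsilon> * Y\<close>.\<close>
  also have "\<dots> = eta Y (\<epsilon> + ln (real M))"
    by (simp add: eta_def algebra_simps)
  finally show ?thesis .
qed

text \<open>Bounds for single \<open>s\<close> cannot be combined through \<open>eta\<close>, which
  need not be monotone. The condition \<open>excess P (marg_E P) (y / M) \<le> y\<close> is closed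
  in \<open>y\<close> instead, so it passes to the infimum, and \<open>eta\<close> enters only
  afterwards.\<close>

lemma Delta_I_min_le_INF:
  assumes P: "prob_dist P" and "M > 0" "\<epsilon> > 0"
  shows "Delta_I_min M \<epsilon> P \<le>
    eta (INF s\<in>{0..}. exp ((- s * H_down s P + s * ln (real M)) / (1 + s))) (\<epsilon> + ln (real M))"
proof (rule Delta_I_min_le_eta[OF assms])
  let ?Y = "\<lambda>s. exp ((- s * H_down s P + s * ln (real M)) / (1 + s))"
  have bdd: "bdd_below (?Y ` {0..})"
    by (rule bdd_belowI2[of _ 0]) simp
  show "0 \<le> (INF s\<in>{0..}. ?Y s)"
    by (rule cINF_greatest) auto
  \<comment> \<open>At \<open>s = 0\<close> the exponent vanishes, so the value is 1.\<close>
  have "(INF s\<in>{0..}. ?Y s) \<le> ?Y 0"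
    by (rule cINF_lower[OF bdd]) simp
  then show "(INF s\<in>{0..}. ?Y s) \<le> 1" by simp
  let ?C = "{y. excess P (marg_E P) (y / real M) \<le> y}"
  have "closed ?C"
    using \<open>M > 0\<close>
    by (intro closed_Collect_le continuous_intros continuous_on_compose2[OF continuous_on_excess[of UNIV]])
      auto
  moreover have "?Y ` {0..} \<subseteq> ?C"
    using excess_marg_E_le_H_down[OF P \<open>M > 0\<close>] by auto
  ultimately have "(INF s\<in>{0..}. ?Y s) \<in> ?C"
    using bdd by (intro closed_subset_contains_Inf) auto
  then show "excess P (marg_E P) ((INF s\<in>{0..}. ?Y s) / real M) \<le> (INF s\<in>{0..}. ?Y s)"
    by simp
qed

theorem theorem24:
  fixes P :: "'a::finite \<times> 'e::finite \<Rightarrow> real"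
    and M :: nat and \<epsilon> R :: real
  assumes "prob_dist P" and "M > 0" and "R = ln (real M)" and "\<epsilon> > 0"
  shows "Delta_d_min M \<epsilon> P \<le>
           ereal ((2 + sqrt \<epsilon>) * (INF s\<in>{0..}. exp ((- s * H_up s P + s * R) / (1 + 2 * s))))
       \<and> Delta_I_min M \<epsilon> P \<le>
           eta (INF s\<in>{0..}. exp ((- s * H_down s P + s * R) / (1 + s))) (\<epsilon> + ln (real M))"
  using Delta_d_min_le_INF[OF assms(1,2,4)] Delta_I_min_le_INF[OF assms(1,2,4)] assms(3) by simp

end
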